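(* A connected $\epsilon$-envy-free allocation for three players can be computed with $O(\log\frac1\epsilon)$ queries in the Robertson–Webb (RW) model. That is, there are constants $C>0$ and $\epsilon_0\in(0,1)$ such that for every $0<\epsilon<\epsilon_0$ there is a deterministic RW protocol which, for every choice of value densities $v_1,v_2,v_3$ of the three players, asks at most $C\log\frac1\epsilon$ queries and outputs a connected $\epsilon$-envy-free allocation.
   Context: Cake cutting model. The cake is $[0,1]$ and the players are $N=\{1,\dots,n\}$ (here $n=3$). Player $i$ has a private non-negative integrable value density $v_i$ on $[0,1]$ with $\int_0^1 v_i=1$, and values a measurable set $S$ at $V_i(S)=\int_S v_i(x)\,dx$. A piece is a finite union of disjoint intervals (shared endpoints are irrelevant, since sets of measure zero are worth zero); it is connected if it is a single interval. An allocation $A=(A_1,\dots,A_n)$ is a partition of $[0,1]$ into pieces, player $i$ receiving $A_i$. It is connected if every $A_i$ is connected, and $\epsilon$-envy-free if $V_i(A_i)\ge V_i(A_j)-\epsilon$ for all $i,j$. RW model. A protocol, not knowing the densities, adaptively asks the players queries of two types: $\mathrm{Cut}_i(\alpha)$, for any $\alpha\in[0,1]$: player $i$ returns a point $y$ with $V_i([0,y])=\alpha$ (ties resolved deterministically, e.g. the leftmost such point), and $y$ becomes a cut point; $\mathrm{Eval}_i(y)$, for a previously made cut point $y$: player $i$ returns $V_i([0,y])$. At the end the protocol outputs an allocation demarcated by cut points discovered through its queries. Protocols are deterministic and the number of queries is counted in the worst case over instances. *)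

theory Defs
  imports "HOL-Analysis.Analysis"
begin

text \<open>Only the values of a density on \<open>[0,1]\<close> matter.\<close>

definition value_density :: "(real \<Rightarrow> real) \<Rightarrow> bool" where
  "value_density v \<longleftrightarrow>
     (\<forall>x\<in>{0..1}. 0 \<le> v x) \<and>
     set_integrable lebesgue {0..1} v \<and>
     set_lebesgue_integral lebesgue {0..1} v = 1"

definition val :: "(real \<Rightarrow> real) \<Rightarrow> real set \<Rightarrow> real" where
  "val v S = set_lebesgue_integral lebesgue S v"

text \<open>The players are \<open>1, \<dots>, n\<close>. Instances and allocations are functions on \<^typ>\<open>nat\<close> of which only
  the values at the players are relevant.\<close>

definition instance_profile :: "nat \<Rightarrow> (nat \<Rightarrow> real \<Rightarrow> real) \<Rightarrow> bool" where
  "instance_profile n v \<longleftrightarrow> (\<forall>i\<in>{1..n}. value_density (v i))"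

text \<open>Intervals may be open, closed, half-open or degenerate, so that an allocation can be required to
  be a partition in the strict sense: a shared endpoint is given to exactly one of the neighbours.\<close>

definition piece :: "real set \<Rightarrow> bool" where
  "piece S \<longleftrightarrow> S \<subseteq> {0..1} \<and>
     (\<exists>F. finite F \<and> disjoint F \<and> (\<forall>I\<in>F. is_interval I) \<and> S = \<Union>F)"

definition allocation :: "nat \<Rightarrow> (nat \<Rightarrow> real set) \<Rightarrow> bool" where
  "allocation n A \<longleftrightarrow>
     (\<forall>i\<in>{1..n}. piece (A i)) \<and>
     disjoint_family_on A {1..n} \<and>
     (\<Union>i\<in>{1..n}. A i) = {0..1}"

definition connected_allocation :: "nat \<Rightarrow> (nat \<Rightarrow> real set) \<Rightarrow> bool" where
  "connected_allocation n A \<longleftrightarrow> allocation n A \<and> (\<forall>i\<in>{1..n}. is_interval (A i))"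

definition envy_free_upto ::
  "nat \<Rightarrow> real \<Rightarrow> (nat \<Rightarrow> real \<Rightarrow> real) \<Rightarrow> (nat \<Rightarrow> real set) \<Rightarrow> bool" where
  "envy_free_upto n \<epsilon> v A \<longleftrightarrow>
     (\<forall>i\<in>{1..n}. \<forall>j\<in>{1..n}. val (v i) (A i) \<ge> val (v i) (A j) - \<epsilon>)"

text \<open>The frontier of a finite union of intervals is the set of its demarcating points; the ends of
  the cake need not be cut.\<close>

definition demarcated_by :: "nat \<Rightarrow> real set \<Rightarrow> (nat \<Rightarrow> real set) \<Rightarrow> bool" where
  "demarcated_by n P A \<longleftrightarrow> (\<forall>i\<in>{1..n}. frontier (A i) \<subseteq> P \<union> {0, 1})"

text \<open>A deterministic adaptive protocol is a decision tree: after a query to player \<open>i\<close> it continues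
  with the subtree selected by the answer, which is all it learns about the densities.\<close>

datatype rw_tree =
    Output "nat \<Rightarrow> real set"
  | Cut nat real "real \<Rightarrow> rw_tree"
  | Eval nat real "real \<Rightarrow> rw_tree"

text \<open>The answer to a cut query; ties are resolved to the left. The minimum is attained, see
  \<open>cut_answer_correct\<close> below.\<close>

definition cut_answer :: "(real \<Rightarrow> real) \<Rightarrow> real \<Rightarrow> real" where
  "cut_answer v \<alpha> = (LEAST y. y \<in> {0..1} \<and> val v {0..y} = \<alpha>)"

definition eval_answer :: "(real \<Rightarrow> real) \<Rightarrow> real \<Rightarrow> real" where
  "eval_answer v y = val v {0..y}"

primrec num_queries :: "(nat \<Rightarrow> real \<Rightarrow> real) \<Rightarrow> rw_tree \<Rightarrow> nat" where
  "num_queries v (Output A) = 0"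
| "num_queries v (Cut i \<alpha> k) = Suc (num_queries v (k (cut_answer (v i) \<alpha>)))"
| "num_queries v (Eval i y k) = Suc (num_queries v (k (eval_answer (v i) y)))"

primrec outcome :: "(nat \<Rightarrow> real \<Rightarrow> real) \<Rightarrow> rw_tree \<Rightarrow> nat \<Rightarrow> real set" where
  "outcome v (Output A) = A"
| "outcome v (Cut i \<alpha> k) = outcome v (k (cut_answer (v i) \<alpha>))"
| "outcome v (Eval i y k) = outcome v (k (eval_answer (v i) y))"

text \<open>The execution on \<open>v\<close> obeys the rules of the model, where \<open>P\<close> is the set of cut points
  made so far.\<close>

primrec legal_run :: "nat \<Rightarrow> (nat \<Rightarrow> real \<Rightarrow> real) \<Rightarrow> rw_tree \<Rightarrow> real set \<Rightarrow> bool" where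
  "legal_run n v (Output A) P \<longleftrightarrow> allocation n A \<and> demarcated_by n P A"
| "legal_run n v (Cut i \<alpha> k) P \<longleftrightarrow> i \<in> {1..n} \<and> \<alpha> \<in> {0..1} \<and>
     legal_run n v (k (cut_answer (v i) \<alpha>)) (insert (cut_answer (v i) \<alpha>) P)"
| "legal_run n v (Eval i y k) P \<longleftrightarrow> i \<in> {1..n} \<and> y \<in> P \<and>
     legal_run n v (k (eval_answer (v i) y)) P"

definition rw_protocol :: "nat \<Rightarrow> rw_tree \<Rightarrow> bool" where
  "rw_protocol n p \<longleftrightarrow> (\<forall>v. instance_profile n v \<longrightarrow> legal_run n v p {})"

lemma cut_answer_correct:
  assumes v: "value_density v" and \<alpha>: "\<alpha> \<in> {0..1}"
  shows "cut_answer v \<alpha> \<in> {0..1}" "val v {0..cut_answer v \<alpha>} = \<alpha>"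
    "\<And>y. y \<in> {0..1} \<Longrightarrow> val v {0..y} = \<alpha> \<Longrightarrow> cut_answer v \<alpha> \<le> y"
proof -
  have int: "set_integrable lebesgue {0..1} v" and one: "val v {0..1} = 1"
    using v by (auto simp: value_density_def val_def)
  have eq: "val v {0..y} = integral {0..y} v" if "y \<in> {0..1}" for y
    unfolding val_def
    by (rule set_lebesgue_integral_eq_integral)
       (use that in \<open>auto intro: set_integrable_subset[OF int]\<close>)
  have "v integrable_on {0..1}"
    using int set_lebesgue_integral_eq_integral(1) by blast
  then have "continuous_on {0..1} (\<lambda>y. integral {0..y} v)"
    by (rule indefinite_integral_continuous_1)
  then have cont: "continuous_on {0..1} (\<lambda>y. val v {0..y})"
    by (subst continuous_on_cong[OF refl eq]) auto
  define S where "S = {y \<in> {0..1}. val v {0..y} = \<alpha>}"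
  have "\<exists>y\<ge>0. y \<le> 1 \<and> val v {0..y} = \<alpha>"
    using \<alpha> one cont eq[of 0] by (intro IVT') auto
  then have "S \<noteq> {}" by (auto simp: S_def)
  have "closed S"
    unfolding S_def by (rule continuous_closed_preimage_constant[OF cont]) auto
  then have "compact S"
    by (metis (no_types, lifting) S_def compact_Icc compact_Int_closed inf.absorb_iff2 mem_Collect_eq subsetI)
  then obtain y where y: "y \<in> S" "\<And>z. z \<in> S \<Longrightarrow> y \<le> z"
    using compact_attains_inf[OF _ \<open>S \<noteq> {}\<close>] by blast
  have "cut_answer v \<alpha> = y"
    unfolding cut_answer_def by (rule Least_equality) (use y in \<open>auto simp: S_def\<close>)
  then show "cut_answer v \<alpha> \<in> {0..1}" "val v {0..cut_answer v \<alpha>} = \<alpha>"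
    "\<And>z. z \<in> {0..1} \<Longrightarrow> val v {0..z} = \<alpha> \<Longrightarrow> cut_answer v \<alpha> \<le> z"
    using y by (auto simp: S_def)
qed

end

theory Submission
  imports Defs
begin

text \<open>Player 1 trisects the cake. If players 2 and 3 have different favourite pieces, this settles
  the matter. Otherwise both favour the same piece \<open>m\<close>, and we shrink \<open>m\<close> to nothing while player 1
  keeps the other two pieces equal. On the way there is a moment at which one of the players 2, 3
  becomes indifferent between \<open>m\<close> and another piece while the other one still favours \<open>m\<close>; this is
  an envy-free division, since player 1 is content with either piece other than \<open>m\<close>.

  The moment is found by bisection, first in the value of \<open>m\<close> to player 1. This leaves two divisions
  which are nearly the same to player 1 but maybe not to the others. Player 1 does not mind in
  which way we pass from one to the other, so the two cuts can be moved one after the other, and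
  the change of preference occurs while a single cut moves. The range of that cut is then bisected
  in the value of player 2 and in the value of player 3. No continuity or monotonicity of the
  preferences along the path is needed: every bisection only maintains that \<open>m\<close> is favoured by both
  at one end and not strictly favoured by both at the other.\<close>

section \<open>Cuts and slices\<close>

text \<open>A cut point together with its evaluations by all players.\<close>

type_synonym point = "real \<times> (nat \<Rightarrow> real)"

definition slice :: "real \<Rightarrow> real \<Rightarrow> nat \<Rightarrow> real set" where
  "slice x y j = (if j = 0 then {0..x} else if j = 1 then {x<..y} else {y<..1})"

text \<open>Computed from evaluations alone, so that a protocol can branch on it;
  \<open>val_slice\<close> links it to the densities.\<close>

definition share :: "nat \<Rightarrow> nat \<Rightarrow> point \<times> point \<Rightarrow> real" where
  "share i j d = (if j = 0 then snd (fst d) i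
     else if j = 1 then snd (snd d) i - snd (fst d) i else 1 - snd (snd d) i)"

definition fair :: "real \<Rightarrow> point \<times> point \<Rightarrow> (nat \<Rightarrow> nat) \<Rightarrow> bool" where
  "fair \<epsilon> d \<sigma> \<longleftrightarrow> bij_betw \<sigma> {1..3} {..<3} \<and>
     (\<forall>i\<in>{1..3}. \<forall>j<3. share i j d \<le> share i (\<sigma> i) d + \<epsilon>)"

definition favoured :: "nat \<Rightarrow> point \<times> point \<Rightarrow> bool" where
  "favoured m d \<longleftrightarrow> (\<forall>i\<in>{2,3}. \<forall>j<3. share i j d \<le> share i m d)"

text \<open>Ties count both here and in \<open>favoured\<close>: the two overlap, and together they
  cover every division.\<close>

definition contested :: "nat \<Rightarrow> point \<times> point \<Rightarrow> bool" where
  "contested m d \<longleftrightarrow> (\<exists>i\<in>{2,3}. \<exists>j<3. j \<noteq> m \<and> share i m d \<le> share i j d)"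

section \<open>Fair assignments from favourites\<close>

lemma less_3_iff: "j < 3 \<longleftrightarrow> j = 0 \<or> j = 1 \<or> j = (2::nat)"
  by auto

lemma atLeastAtMost_1_3: "{1..3} = {1, 2, 3::nat}" "{Suc 0..3} = {1, 2, 3}"
  by auto

lemma not_favoured_imp_contested: "\<not> favoured m d \<Longrightarrow> contested m d"
  unfolding favoured_def contested_def by (metis less_imp_le linorder_not_less order_refl)

text \<open>The indices 0, 1, 2 sum to 3, so \<open>3 - a - b\<close> is the piece left to player
  1.\<close>

lemma assignment_bij:
  fixes a b :: nat
  assumes "a < 3" "b < 3" "a \<noteq> b"
  shows "bij_betw ((\<lambda>_. 3 - a - b)(2::nat := a, 3 := b)) {1..3} {..<3}"
proof -
  have three: "{..<3} = {0, 1, 2::nat}" by auto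
  from assms show ?thesis
    unfolding bij_betw_def atLeastAtMost_1_3 less_3_iff three
    by (elim disjE) (simp_all, auto)
qed

lemma fair_assignment:
  assumes "a < 3" "b < 3" "a \<noteq> b"
    and "\<And>j. j < 3 \<Longrightarrow> share 1 j d \<le> share 1 (3 - a - b) d + \<epsilon>"
    and "\<And>j. j < 3 \<Longrightarrow> share 2 j d \<le> share 2 a d + \<epsilon>"
    and "\<And>j. j < 3 \<Longrightarrow> share 3 j d \<le> share 3 b d + \<epsilon>"
  shows "\<exists>\<sigma>. fair \<epsilon> d \<sigma>"
  using assms(4-) assignment_bij[OF assms(1-3)] unfolding fair_def atLeastAtMost_1_3
  by (intro exI[of _ "(\<lambda>_. 3 - a - b)(2 := a, 3 := b)"]) simp

lemma favourite_exists: "\<exists>a<3. \<forall>j<3. share i j d \<le> share i a d"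
proof -
  obtain a where "a \<in> {..<3::nat}" "\<And>j. j \<in> {..<3} \<Longrightarrow> \<not> share i j d > share i a d"
    using arg_min_if_finite[of "{..<3::nat}" "\<lambda>j. - share i j d"] by force
  then show ?thesis by (meson lessThan_iff linorder_not_less)
qed

text \<open>Different favourites of players 2 and 3 can both be granted, since player 1 accepts any
  piece; a common favourite is the piece \<open>m\<close>.\<close>

lemma fair_or_favoured:
  assumes "\<And>j. j < 3 \<Longrightarrow> share 1 j d = 1 / 3" and "\<epsilon> \<ge> 0"
  shows "(\<exists>\<sigma>. fair \<epsilon> d \<sigma>) \<or> (\<exists>m<3. favoured m d)"
proof -
  obtain a where a: "a < 3" "\<And>j. j < 3 \<Longrightarrow> share 2 j d \<le> share 2 a d"
    using favourite_exists by blast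
  obtain b where b: "b < 3" "\<And>j. j < 3 \<Longrightarrow> share 3 j d \<le> share 3 b d"
    using favourite_exists by blast
  show ?thesis
  proof (cases "a = b")
    case True
    then show ?thesis using a b by (auto simp: favoured_def)
  next
    case False
    then have "3 - a - b < 3" using a(1) b(1) by (auto simp: less_3_iff)
    then have "share 1 j d \<le> share 1 (3 - a - b) d + \<epsilon>" if "j < 3" for j
      using assms(1)[of "3 - a - b"] assms(1)[OF that] \<open>\<epsilon> \<ge> 0\<close> by linarith
    then show ?thesis
      using False a b \<open>\<epsilon> \<ge> 0\<close> by (intro disjI1 fair_assignment[of a b]) (auto intro: add_increasing2)
  qed
qed

text \<open>Some player \<open>i\<close> weakly prefers a piece \<open>a\<close> to \<open>m\<close>
  at \<open>d'\<close>, hence up to \<open>2 * \<delta>\<close> at \<open>d\<close>. Give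
  \<open>a\<close> to \<open>i\<close> and \<open>m\<close> to the other one of players 2 and 3; the
  third piece is not \<open>m\<close> and so suits player 1.\<close>

lemma fair_of_change:
  assumes m: "m < 3" and fav: "favoured m d" and con: "contested m d'"
    and close: "\<And>i j. i \<in> {2,3} \<Longrightarrow> j < 3 \<Longrightarrow> \<bar>share i j d - share i j d'\<bar> \<le> \<delta>"
    and content: "\<And>j k. j < 3 \<Longrightarrow> k < 3 \<Longrightarrow> k \<noteq> m \<Longrightarrow> share 1 j d \<le> share 1 k d + 4 * \<delta>"
    and "\<delta> \<ge> 0"
  shows "\<exists>\<sigma>. fair (4 * \<delta>) d \<sigma>"
proof -
  obtain i a where i: "i \<in> {2,3}" and a: "a < 3" "a \<noteq> m" "share i m d' \<le> share i a d'"
    using con by (auto simp: contested_def)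
  have ia: "share i j d \<le> share i a d + 4 * \<delta>" if "j < 3" for j
  proof -
    have "share i j d \<le> share i m d" using fav i that by (auto simp: favoured_def)
    then show ?thesis using close[OF i m] close[OF i a(1)] a(3) \<open>\<delta> \<ge> 0\<close> by linarith
  qed
  have m': "share k j d \<le> share k m d + 4 * \<delta>" if "j < 3" "k \<in> {2,3}" for j k
    using fav that \<open>\<delta> \<ge> 0\<close> by (force simp: favoured_def)
  have rest: "3 - a - m < 3" "3 - a - m \<noteq> m" "3 - m - a < 3" "3 - m - a \<noteq> m"
    using a m by (auto simp: less_3_iff)
  show ?thesis
  proof (cases "i = 2")
    case True
    then show ?thesis using a m ia m' content rest by (intro fair_assignment[of a m]) auto
  next
    case False
    then have "i = 3" using i by auto
    then show ?thesis using a m ia m' content rest by (intro fair_assignment[of m a]) auto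
  qed
qed

section \<open>The protocol\<close>

text \<open>Evaluating each new cut for all players at once makes every later decision free of
  queries. The value of player 1 is the default of the updated function.\<close>

definition probe :: "nat \<Rightarrow> real \<Rightarrow> (point \<Rightarrow> rw_tree) \<Rightarrow> rw_tree" where
  "probe i \<alpha> k = Cut i \<alpha> (\<lambda>y. Eval 1 y (\<lambda>a. Eval 2 y (\<lambda>b. Eval 3 y (\<lambda>c.
     k (y, (\<lambda>_. a)(2 := b, 3 := c))))))"

definition finish :: "real \<Rightarrow> point \<times> point \<Rightarrow> rw_tree" where
  "finish \<epsilon> d = Output (slice (fst (fst d)) (fst (snd d)) \<circ> (SOME \<sigma>. fair \<epsilon> d \<sigma>))"

text \<open>The test for equal values is needed because the cut answer is leftmost: only if its value lies
  strictly between those of the end points is it guaranteed to lie between them.\<close>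

primrec bisect :: "nat \<Rightarrow> nat \<Rightarrow> (point \<Rightarrow> point \<times> point) \<Rightarrow> nat \<Rightarrow> (point \<Rightarrow> point \<Rightarrow> rw_tree)
    \<Rightarrow> point \<Rightarrow> point \<Rightarrow> rw_tree" where
  "bisect m i f 0 k a b = k a b"
| "bisect m i f (Suc n) k a b = (if snd a i = snd b i then k a b
     else probe i ((snd a i + snd b i) / 2)
       (\<lambda>c. if favoured m (f c) then bisect m i f n k c b else bisect m i f n k a c))"

text \<open>\<open>f\<close> keeps one cut fixed. The range left by bisecting in the value of player
  2 is bisected again in that of player 3, and the favoured end is output.\<close>

definition move_cut :: "real \<Rightarrow> nat \<Rightarrow> nat \<Rightarrow> (point \<Rightarrow> point \<times> point) \<Rightarrow> point \<Rightarrow> point \<Rightarrow> rw_tree" where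
  "move_cut \<epsilon> n m f =
     bisect m 2 f n (bisect m 3 f n (\<lambda>a b. finish \<epsilon> (f a)))"

text \<open>The way from \<open>d\<close> to \<open>d'\<close> has the corner
  \<open>(fst d, snd d')\<close>; the preferences there tell on which leg a change from favoured to
  contested is certain.\<close>

definition refine :: "real \<Rightarrow> nat \<Rightarrow> nat \<Rightarrow> point \<times> point \<Rightarrow> point \<times> point \<Rightarrow> rw_tree" where
  "refine \<epsilon> n m d d' = (if favoured m (fst d, snd d')
     then move_cut \<epsilon> n m (\<lambda>p. (p, snd d')) (fst d) (fst d')
     else move_cut \<epsilon> n m (\<lambda>p. (fst d, p)) (snd d) (snd d'))"

text \<open>The values to player 1 of everything left of the two cuts, when piece \<open>m\<close> is worth \<open>s\<close> and the
  other two are worth the same.\<close>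

definition left_goal :: "nat \<Rightarrow> real \<Rightarrow> real" where
  "left_goal m s = (if m = 0 then s else (1 - s) / 2)"

definition right_goal :: "nat \<Rightarrow> real \<Rightarrow> real" where
  "right_goal m s = (if m = 2 then 1 - s else (1 + s) / 2)"

primrec shrink :: "nat \<Rightarrow> nat \<Rightarrow> (point \<times> point \<Rightarrow> point \<times> point \<Rightarrow> rw_tree)
    \<Rightarrow> real \<Rightarrow> real \<Rightarrow> point \<times> point \<Rightarrow> point \<times> point \<Rightarrow> rw_tree" where
  "shrink m 0 k s t d d' = k d d'"
| "shrink m (Suc n) k s t d d' =
     probe 1 (left_goal m ((s + t) / 2)) (\<lambda>x. probe 1 (right_goal m ((s + t) / 2)) (\<lambda>y.
       if favoured m (x, y) then shrink m n k ((s + t) / 2) t (x, y) d'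
       else shrink m n k s ((s + t) / 2) d (x, y)))"

definition start_point :: point where "start_point = (0, \<lambda>_. 0)"

definition end_point :: point where "end_point = (1, \<lambda>_. 1)"

text \<open>The end of the path cannot be cut by player 1 if \<open>m\<close> is the right piece: the leftmost point with
  nothing to the right of it in player 1's eyes may well leave something to the other players.\<close>

definition vanished :: "nat \<Rightarrow> point \<Rightarrow> point \<times> point" where
  "vanished m c = (if m = 0 then start_point else c, if m = 2 then end_point else c)"

text \<open>Whichever piece vanishes, player 1 has to halve the cake, hence the probe at 1/2. The
  same \<open>n\<close> bounds the rounds of all three bisections.\<close>

definition protocol :: "real \<Rightarrow> nat \<Rightarrow> rw_tree" where
  "protocol \<epsilon> n = probe 1 (1/3) (\<lambda>x. probe 1 (2/3) (\<lambda>y.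
     if \<exists>\<sigma>. fair \<epsilon> (x, y) \<sigma> then finish \<epsilon> (x, y)
     else let m = SOME m. m < 3 \<and> favoured m (x, y) in
       probe 1 (1/2) (\<lambda>c. shrink m n (refine \<epsilon> n m) (1/3) 0 (x, y) (vanished m c))))"

section \<open>Correctness\<close>

locale three_players =
  fixes v :: "nat \<Rightarrow> real \<Rightarrow> real"
  assumes profile: "instance_profile 3 v"
begin

section \<open>Values of intervals\<close>

lemma density: "i \<in> {1..3} \<Longrightarrow> value_density (v i)"
  using profile by (simp add: instance_profile_def)

lemma integrable_on_subset:
  assumes "i \<in> {1..3}" "S \<subseteq> {0..1}" "S \<in> sets lebesgue"
  shows "set_integrable lebesgue S (v i)"
  using density[OF assms(1)] assms(2,3) by (auto simp: value_density_def intro: set_integrable_subset)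

lemma val_Ioc:
  assumes "i \<in> {1..3}" "0 \<le> x" "x \<le> y" "y \<le> 1"
  shows "val (v i) {x<..y} = val (v i) {0..y} - val (v i) {0..x}"
proof -
  have "{0..y} = {0..x} \<union> {x<..y}" using assms by auto
  moreover have "val (v i) ({0..x} \<union> {x<..y}) = val (v i) {0..x} + val (v i) {x<..y}"
    unfolding val_def using assms by (intro set_integral_Un integrable_on_subset) auto
  ultimately show ?thesis by simp
qed

lemma val_1: "i \<in> {1..3} \<Longrightarrow> val (v i) {0..1} = 1"
  using density by (simp add: value_density_def val_def)

lemma val_0: "i \<in> {1..3} \<Longrightarrow> val (v i) {0} = 0"
proof -
  assume i: "i \<in> {1..3}"
  have "val (v i) {0} = integral {0} (v i)"
    unfolding val_def using i by (intro set_lebesgue_integral_eq_integral integrable_on_subset) auto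
  then show ?thesis by simp
qed

lemma val_mono:
  assumes "i \<in> {1..3}" "0 \<le> x" "x \<le> y" "y \<le> 1"
  shows "val (v i) {0..x} \<le> val (v i) {0..y}"
proof -
  have "0 \<le> val (v i) {x<..y}"
    unfolding val_def set_lebesgue_integral_def
    using density[OF assms(1)] assms
    by (intro integral_nonneg_AE AE_I2) (auto simp: value_density_def indicator_def)
  then show ?thesis using val_Ioc[OF assms] by simp
qed

definition known :: "real set \<Rightarrow> point \<Rightarrow> bool" where
  "known P p \<longleftrightarrow> fst p \<in> {0..1} \<and> fst p \<in> P \<union> {0, 1} \<and>
     (\<forall>i\<in>{1..3}. snd p i = val (v i) {0..fst p})"

lemma known_mono: "known P p \<Longrightarrow> P \<subseteq> Q \<Longrightarrow> known Q p"
  by (auto simp: known_def)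

lemma known_value_mono:
  "known P p \<Longrightarrow> known Q q \<Longrightarrow> fst p \<le> fst q \<Longrightarrow> i \<in> {1..3} \<Longrightarrow> snd p i \<le> snd q i"
  by (simp add: known_def val_mono)

lemma known_value_bounds: "known P p \<Longrightarrow> i \<in> {1..3} \<Longrightarrow> 0 \<le> snd p i \<and> snd p i \<le> 1"
  using val_mono[of i 0 "fst p"] val_mono[of i "fst p" 1] by (simp add: known_def val_0 val_1)

lemma known_start_point: "known P start_point"
  and known_end_point: "known P end_point"
  using val_0 val_1 by (auto simp: known_def start_point_def end_point_def)

text \<open>A contract for a subtree entered with cut points \<open>P\<close>; the budgets
  \<open>N\<close> add up along the tree.\<close>

definition solves :: "real \<Rightarrow> nat \<Rightarrow> real set \<Rightarrow> rw_tree \<Rightarrow> bool" where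
  "solves \<epsilon> N P p \<longleftrightarrow> legal_run 3 v p P \<and> num_queries v p \<le> N \<and>
     connected_allocation 3 (outcome v p) \<and> envy_free_upto 3 \<epsilon> v (outcome v p)"

lemma solves_mono: "solves \<epsilon> N P p \<Longrightarrow> N \<le> M \<Longrightarrow> solves \<epsilon> M P p"
  by (auto simp: solves_def)

text \<open>The evaluations are legal because the cut point has just been added to \<open>P\<close>.
  The premise ranges over all larger sets \<open>Q\<close>, which spares its users the exact list of
  cut points.\<close>

lemma solves_probe:
  assumes i: "i \<in> {1..3}" and \<alpha>: "\<alpha> \<in> {0..1}"
    and k: "\<And>p Q. P \<subseteq> Q \<Longrightarrow> known Q p \<Longrightarrow> fst p = cut_answer (v i) \<alpha> \<Longrightarrow> snd p i = \<alpha> \<Longrightarrow>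
      solves \<epsilon> N Q (k p)"
  shows "solves \<epsilon> (N + 4) P (probe i \<alpha> k)"
proof -
  define y where "y = cut_answer (v i) \<alpha>"
  define p where "p = (y, (\<lambda>_. eval_answer (v 1) y)(2 :: nat := eval_answer (v 2) y, 3 := eval_answer (v 3) y))"
  have y: "y \<in> {0..1}" "val (v i) {0..y} = \<alpha>"
    using cut_answer_correct[OF density[OF i] \<alpha>] by (auto simp: y_def)
  have p: "snd p j = val (v j) {0..y}" if "j \<in> {1..3}" for j
    using that by (auto simp: p_def atLeastAtMost_1_3 eval_answer_def)
  have "solves \<epsilon> N (insert y P) (k p)"
    using y p i by (intro k) (auto simp: known_def p_def y_def)
  then show ?thesis
    using i \<alpha> by (auto simp: solves_def probe_def p_def y_def)
qed

section \<open>Slices as connected allocations\<close>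

lemma slice_interval: "is_interval (slice x y j)"
  by (auto simp: slice_def is_interval_1)

lemma slice_frontier:
  assumes "x \<le> y"
  shows "frontier (slice x y j) \<subseteq> {x, y, 0, 1}"
proof -
  \<comment> \<open>One claim for closed, half-open and empty slices alike.\<close>
  have *: "frontier S \<subseteq> {a, b}" if "{a<..<b} \<subseteq> S" "S \<subseteq> {a..b}" for S and a b :: real
  proof -
    have "frontier S \<subseteq> {a..b} - {a<..<b}"
      unfolding frontier_def using that by (intro Diff_mono closure_minimal interior_maximal) auto
    then show ?thesis by auto
  qed
  have "frontier {0..x} \<subseteq> {0, x}" "frontier {x<..y} \<subseteq> {x, y}" "frontier {y<..1} \<subseteq> {y, 1}"
    by (intro *; auto)+
  then show ?thesis by (auto simp: slice_def)
qed

lemma slice_allocation: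
  assumes xy: "0 \<le> x" "x \<le> y" "y \<le> 1" and \<sigma>: "bij_betw \<sigma> {1..3} {..<3}"
  shows "connected_allocation 3 (slice x y \<circ> \<sigma>)"
proof -
  have "piece (slice x y j)" for j
    unfolding piece_def using xy slice_interval[of x y j]
    by (intro conjI exI[of _ "{slice x y j}"]) (auto simp: slice_def)
  moreover have "disjoint_family_on (slice x y \<circ> \<sigma>) {1..3}"
    unfolding disjoint_family_on_def
  proof (intro ballI impI)
    fix i j :: nat assume ij: "i \<in> {1..3}" "j \<in> {1..3}" "i \<noteq> j"
    then have "\<sigma> i \<noteq> \<sigma> j" using \<sigma> by (auto simp: bij_betw_def inj_on_def)
    moreover have "\<sigma> i < 3" "\<sigma> j < 3" using \<sigma> ij by (auto simp: bij_betw_def)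
    ultimately show "(slice x y \<circ> \<sigma>) i \<inter> (slice x y \<circ> \<sigma>) j = {}"
      using xy by (auto simp: slice_def)
  qed
  moreover have "(\<Union>i\<in>{1..3}. (slice x y \<circ> \<sigma>) i) = (\<Union>j\<in>{..<3}. slice x y j)"
    using bij_betw_imp_surj_on[OF \<sigma>] by (metis image_comp)
  moreover have "(\<Union>j\<in>{..<3}. slice x y j) = {0..1}"
  proof -
    have three: "{..<3} = {0, 1, 2::nat}" by auto
    have "(\<Union>j\<in>{..<3}. slice x y j) = {0..x} \<union> {x<..y} \<union> {y<..1}"
      unfolding three by (simp add: slice_def Un_ac)
    also have "\<dots> = {0..1}" using xy by auto
    finally show ?thesis .
  qed
  ultimately show ?thesis
    using slice_interval by (simp add: connected_allocation_def allocation_def)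
qed

lemma val_slice:
  assumes "known P x" "known P y" "fst x \<le> fst y" "i \<in> {1..3}"
  shows "val (v i) (slice (fst x) (fst y) j) = share i j (x, y)"
  using assms by (auto simp: slice_def share_def known_def val_Ioc val_1)

lemma solves_finish:
  assumes xy: "known P x" "known P y" "fst x \<le> fst y" and fair: "\<exists>\<sigma>. fair \<epsilon> (x, y) \<sigma>"
  shows "solves \<epsilon> 0 P (finish \<epsilon> (x, y))"
proof -
  define \<sigma> where "\<sigma> = (SOME \<sigma>. fair \<epsilon> (x, y) \<sigma>)"
  have "fair \<epsilon> (x, y) \<sigma>" using fair unfolding \<sigma>_def by (rule someI_ex)
  then have bij: "bij_betw \<sigma> {1..3} {..<3}"
    and le: "\<And>i j. i \<in> {1..3} \<Longrightarrow> j < 3 \<Longrightarrow> share i j (x, y) \<le> share i (\<sigma> i) (x, y) + \<epsilon>"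
    by (auto simp: fair_def)
  let ?A = "slice (fst x) (fst y) \<circ> \<sigma>"
  have con: "connected_allocation 3 ?A"
    using xy bij by (intro slice_allocation) (auto simp: known_def)
  have "\<sigma> j < 3" if "j \<in> {1..3}" for j using bij that by (auto simp: bij_betw_def)
  then have "envy_free_upto 3 \<epsilon> v ?A"
    using le unfolding envy_free_upto_def by (simp add: val_slice[OF xy] algebra_simps)
  moreover have "demarcated_by 3 P ?A"
    using slice_frontier[OF xy(3)] xy(1,2) unfolding demarcated_by_def known_def by fastforce
  ultimately show ?thesis
    using con by (simp add: solves_def finish_def connected_allocation_def flip: \<sigma>_def)
qed

section \<open>Bisection along a single moving cut\<close>

definition between :: "point \<Rightarrow> point \<Rightarrow> point \<Rightarrow> bool" where
  "between a b p \<longleftrightarrow> min (fst a) (fst b) \<le> fst p \<and> fst p \<le> max (fst a) (fst b)"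

lemma between_ends: "between a b a" "between a b b"
  by (auto simp: between_def)

lemma between_trans: "between a b c \<Longrightarrow> between a b d \<Longrightarrow> between c d p \<Longrightarrow> between a b p"
  by (auto simp: between_def)

text \<open>\<open>a\<close> may lie on either side of \<open>b\<close>, as the direction in which a
  cut moves depends on \<open>m\<close>; hence the minima and maxima.\<close>

lemma between_value:
  assumes "known P a" "known P b" "known Q p" "between a b p" "i \<in> {1..3}"
  shows "min (snd a i) (snd b i) \<le> snd p i \<and> snd p i \<le> max (snd a i) (snd b i)"
proof (cases "fst a \<le> fst b")
  case True
  then show ?thesis
    using known_value_mono[OF assms(1,3) _ assms(5)] known_value_mono[OF assms(3,2) _ assms(5)] assms(4)
    by (auto simp: between_def min_def max_def)
next
  case False
  then show ?thesis
    using known_value_mono[OF assms(2,3) _ assms(5)] known_value_mono[OF assms(3,1) _ assms(5)] assms(4)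
    by (auto simp: between_def min_def max_def)
qed

text \<open>This preserves the closeness reached for player 2 while the range shrinks further for
  player 3.\<close>

lemma between_value_dist:
  assumes "known P a" "known P b" "known Q p" "known Q q" "between a b p" "between a b q" "i \<in> {1..3}"
  shows "\<bar>snd p i - snd q i\<bar> \<le> \<bar>snd a i - snd b i\<bar>"
  using between_value[OF assms(1,2,3,5,7)] between_value[OF assms(1,2,4,6,7)] by linarith

text \<open>By monotonicity a point outside has a value at or beyond that of an end. Strictness
  matters: a stretch worth nothing to \<open>i\<close> may adjoin an end from outside.\<close>

lemma between_if_value_between:
  assumes "known P a" "known P b" "known Q c" "i \<in> {1..3}"
    and "min (snd a i) (snd b i) < snd c i" "snd c i < max (snd a i) (snd b i)"
  shows "between a b c"
proof (rule ccontr)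
  assume "\<not> between a b c"
  then consider "fst c \<le> fst a" "fst c \<le> fst b" | "fst a \<le> fst c" "fst b \<le> fst c"
    by (fastforce simp: between_def)
  then show False
    using known_value_mono[OF assms(3,1)] known_value_mono[OF assms(3,2)]
      known_value_mono[OF assms(1,3)] known_value_mono[OF assms(2,3)] assms(4-6)
    by cases force+
qed

text \<open>Invariant: \<open>a\<close> is favoured, \<open>b\<close> is contested, and each probe
  of four queries halves their gap in value to \<open>i\<close>.\<close>

lemma solves_bisect:
  assumes i: "i \<in> {1..3}" and "known P a" "known P b" "favoured m (f a)" "contested m (f b)"
    and "\<bar>snd a i - snd b i\<bar> \<le> w * 2 ^ n" "w \<ge> 0"
    and "\<And>Q c d. P \<subseteq> Q \<Longrightarrow> known Q c \<Longrightarrow> known Q d \<Longrightarrow> between a b c \<Longrightarrow> between a b d \<Longrightarrow>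
      favoured m (f c) \<Longrightarrow> contested m (f d) \<Longrightarrow> \<bar>snd c i - snd d i\<bar> \<le> w \<Longrightarrow> solves \<epsilon> N Q (k c d)"
  shows "solves \<epsilon> (N + 4 * n) P (bisect m i f n k a b)"
  using assms(2-)
proof (induction n arbitrary: P a b)
  case 0
  then show ?case by (simp add: between_ends)
next
  case (Suc n)
  show ?case
  proof (cases "snd a i = snd b i")
    case True
    \<comment> \<open>A zero gap is already within \<open>w\<close>, so stopping early is
      sound.\<close>
    then have "solves \<epsilon> N P (k a b)"
      using Suc.prems by (intro Suc.prems(7)) (auto simp: between_ends)
    then show ?thesis using True by (auto intro: solves_mono)
  next
    case False
    let ?mid = "(snd a i + snd b i) / 2"
    have mid: "?mid \<in> {0..1}"
      using known_value_bounds[OF Suc.prems(1) i] known_value_bounds[OF Suc.prems(2) i] by auto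
    have "solves \<epsilon> ((N + 4 * n) + 4) P (probe i ?mid
       (\<lambda>c. if favoured m (f c) then bisect m i f n k c b else bisect m i f n k a c))"
    proof (rule solves_probe[OF i mid])
      fix c Q assume c: "P \<subseteq> Q" "known Q c" "snd c i = ?mid"
      have ab: "known Q a" "known Q b" using Suc.prems(1,2) c(1) known_mono by auto
      \<comment> \<open>As the ends differ in value, the midpoint lies strictly between them, which
        locates \<open>c\<close>.\<close>
      have btw: "between a b c"
        using False c(3) by (intro between_if_value_between[OF Suc.prems(1,2) c(2) i]) auto
      have w: "\<bar>snd c i - snd b i\<bar> \<le> w * 2 ^ n" "\<bar>snd a i - snd c i\<bar> \<le> w * 2 ^ n"
        using c(3) Suc.prems(5) by (auto simp: abs_if field_simps split: if_splits)
      show "solves \<epsilon> (N + 4 * n) Q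
        (if favoured m (f c) then bisect m i f n k c b else bisect m i f n k a c)"
      proof (cases "favoured m (f c)")
        case True
        have "solves \<epsilon> (N + 4 * n) Q (bisect m i f n k c b)"
          using c ab w(1) True Suc.prems(4,6) btw
          by (intro Suc.IH Suc.prems(7)) (auto intro: between_trans[OF btw between_ends(2)])
        then show ?thesis using True by simp
      next
        case False
        have "solves \<epsilon> (N + 4 * n) Q (bisect m i f n k a c)"
          using c ab w(2) not_favoured_imp_contested[OF False] Suc.prems(3,6) btw
          by (intro Suc.IH Suc.prems(7)) (auto intro: between_trans[OF between_ends(1) btw])
        then show ?thesis using False by simp
      qed
    qed
    then show ?thesis using False by (simp add: algebra_simps)
  qed
qed

lemma solves_move_cut:
  assumes m: "m < 3" and ab: "known P a" "known P b" and "favoured m (f a)" "contested m (f b)"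
    and \<delta>: "1 / 2 ^ n \<le> \<delta>"
    and f: "(\<exists>y. known P y \<and> f = (\<lambda>p. (p, y))) \<or> (\<exists>x. known P x \<and> f = (\<lambda>p. (x, p)))"
    and ordered: "\<And>p. between a b p \<Longrightarrow> fst (fst (f p)) \<le> fst (snd (f p))"
    and content: "\<And>Q p j k. known Q p \<Longrightarrow> between a b p \<Longrightarrow> j < 3 \<Longrightarrow> k < 3 \<Longrightarrow> k \<noteq> m \<Longrightarrow>
      share 1 j (f p) \<le> share 1 k (f p) + 4 * \<delta>"
  shows "solves (4 * \<delta>) (8 * n) P (move_cut (4 * \<delta>) n m f a b)"
proof -
  have "0 < \<delta>" using \<delta> by (smt (verit) divide_pos_pos zero_less_power)
  have 1: "1 \<le> \<delta> * 2 ^ n" using \<delta> by (simp add: field_simps)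
  \<comment> \<open>All values lie in \<open>{0..1}\<close>, so any initial gap is at most 1, which
    \<open>n\<close> halvings bring down to \<open>\<delta>\<close>.\<close>
  have w: "\<bar>snd c i - snd d i\<bar> \<le> \<delta> * 2 ^ n" if "known Q c" "known Q d" "i \<in> {1..3}" for Q c d i
    using known_value_bounds[OF that(1,3)] known_value_bounds[OF that(2,3)] 1 by linarith
  \<comment> \<open>Only one cut moves, and a share depends on its value with coefficient 0, 1 or
    -1.\<close>
  have lipschitz: "\<bar>share i j (f c) - share i j (f d)\<bar> \<le> \<bar>snd c i - snd d i\<bar>" for i j c d
    using f by (auto simp: share_def)
  have "solves (4 * \<delta>) ((0 + 4 * n) + 4 * n) P (move_cut (4 * \<delta>) n m f a b)"
    unfolding move_cut_def
  proof (rule solves_bisect)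
    fix Q c d
    assume cd: "P \<subseteq> Q" "known Q c" "known Q d" "between a b c" "between a b d"
      "favoured m (f c)" "contested m (f d)" "\<bar>snd c 2 - snd d 2\<bar> \<le> \<delta>"
    show "solves (4 * \<delta>) (0 + 4 * n) Q (bisect m 3 f n (\<lambda>a b. finish (4 * \<delta>) (f a)) c d)"
    proof (rule solves_bisect)
      fix R p q
      assume pq: "Q \<subseteq> R" "known R p" "known R q" "between c d p" "between c d q"
        "favoured m (f p)" "contested m (f q)" "\<bar>snd p 3 - snd q 3\<bar> \<le> \<delta>"
      have p: "between a b p" using between_trans cd(4,5) pq(4) by blast
      have "\<bar>snd p 2 - snd q 2\<bar> \<le> \<delta>"
        using between_value_dist[OF cd(2,3) pq(2,3,4,5), of 2] cd(8) by simp
      then have "\<exists>\<sigma>. fair (4 * \<delta>) (f p) \<sigma>"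
        using lipschitz[of 2 _ p q] lipschitz[of 3 _ p q] pq(8) \<open>0 < \<delta>\<close> content[OF pq(2) p]
        by (intro fair_of_change[OF m pq(6,7)]) (auto intro: order_trans)
      moreover have "P \<subseteq> R" using cd(1) pq(1) by blast
      then have "known R (fst (f p))" "known R (snd (f p))" using f pq(2) known_mono by auto
      ultimately show "solves (4 * \<delta>) 0 R (finish (4 * \<delta>) (f p))"
        using solves_finish[of R "fst (f p)" "snd (f p)"] ordered[OF p] by simp
    qed (use cd w \<open>0 < \<delta>\<close> in auto)
  qed (use assms w \<open>0 < \<delta>\<close> in auto)
  then show ?thesis by simp
qed

section \<open>The path of divisions kept by player 1\<close>

text \<open>The leftmost half point of player 1 separates the cuts. This keeps them in order when
  cuts of two divisions are combined, which weak inequalities between values would not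
  ensure.\<close>

definition on_path :: "nat \<Rightarrow> real \<Rightarrow> real set \<Rightarrow> point \<times> point \<Rightarrow> bool" where
  "on_path m s P d \<longleftrightarrow> known P (fst d) \<and> known P (snd d) \<and>
     snd (fst d) 1 = left_goal m s \<and> snd (snd d) 1 = right_goal m s \<and>
     fst (fst d) \<le> cut_answer (v 1) (1/2) \<and> cut_answer (v 1) (1/2) \<le> fst (snd d)"

lemma on_path_mono: "on_path m s P d \<Longrightarrow> P \<subseteq> Q \<Longrightarrow> on_path m s Q d"
  by (auto simp: on_path_def intro: known_mono)

lemma goal_bounds:
  assumes "0 \<le> s" "s \<le> 1/3"
  shows "0 \<le> left_goal m s" "left_goal m s \<le> 1/2" "1/2 \<le> right_goal m s" "right_goal m s \<le> 1"
  using assms by (auto simp: left_goal_def right_goal_def)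

text \<open>On the path the pieces other than \<open>m\<close> are worth \<open>(1 - s) / 2\<close>
  each, and \<open>m\<close> is worth \<open>s\<close>, which is no more since
  \<open>s \<le> 1/3\<close>. A piece has at most two displaced ends, so each of the two compared
  shares contributes an error of at most \<open>2 * \<delta>\<close>.\<close>

lemma content_near_path:
  assumes "s \<le> 1/3" "\<bar>snd x 1 - left_goal m s\<bar> \<le> \<delta>" "\<bar>snd y 1 - right_goal m s\<bar> \<le> \<delta>"
    and "m < 3" "j < 3" "k < 3" "k \<noteq> m"
  shows "share 1 j (x, y) \<le> share 1 k (x, y) + 4 * \<delta>"
proof -
  have x: "left_goal m s - \<delta> \<le> snd x 1" "snd x 1 \<le> left_goal m s + \<delta>"
    and y: "right_goal m s - \<delta> \<le> snd y 1" "snd y 1 \<le> right_goal m s + \<delta>"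
    using assms(2,3) by linarith+
  have "share 1 j (x, y) \<le> (1 - s) / 2 + 2 * \<delta>"
    using x y assms(1) \<open>m < 3\<close> \<open>j < 3\<close> unfolding less_3_iff
    by (elim disjE) (simp_all add: share_def left_goal_def right_goal_def field_simps)
  moreover have "(1 - s) / 2 - 2 * \<delta> \<le> share 1 k (x, y)"
    using x y assms(1) \<open>m < 3\<close> \<open>k < 3\<close> \<open>k \<noteq> m\<close> unfolding less_3_iff
    by (elim disjE) (simp_all add: share_def left_goal_def right_goal_def field_simps)
  ultimately show ?thesis by linarith
qed

text \<open>On both legs the values of the cuts to player 1 stay within \<open>\<delta>\<close> of
  the goals at \<open>s\<close>, so player 1 stays content with any piece but
  \<open>m\<close>.\<close>

lemma solves_refine:
  assumes m: "m < 3" and d: "on_path m s P d" "favoured m d" and d': "on_path m t P d'" "contested m d'"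
    and s: "s \<le> 1/3" and st: "\<bar>s - t\<bar> \<le> \<delta>" and \<delta>: "1 / 2 ^ n \<le> \<delta>"
  shows "solves (4 * \<delta>) (8 * n) P (refine (4 * \<delta>) n m d d')"
proof -
  obtain x y where [simp]: "d = (x, y)" by (cases d)
  obtain x' y' where [simp]: "d' = (x', y')" by (cases d')
  have known: "known P x" "known P y" "known P x'" "known P y'"
    using d(1) d'(1) by (auto simp: on_path_def)
  \<comment> \<open>As functions of \<open>s\<close> the goals have slope 1/2 or 1 in absolute
    value.\<close>
  have goals: "\<bar>left_goal m t - left_goal m s\<bar> \<le> \<delta>" "\<bar>right_goal m t - right_goal m s\<bar> \<le> \<delta>"
    using st by (auto simp: left_goal_def right_goal_def abs_le_iff field_simps)
  have v: "snd x 1 = left_goal m s" "snd y 1 = right_goal m s"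
     "snd x' 1 = left_goal m t" "snd y' 1 = right_goal m t"
    using d(1) d'(1) by (auto simp: on_path_def)
  have x: "\<bar>snd p 1 - left_goal m s\<bar> \<le> \<delta>" if "known Q p" "between x x' p" for Q p
    using between_value[OF known(1,3) that, of 1] goals v by (auto simp: abs_le_iff)
  have y: "\<bar>snd p 1 - right_goal m s\<bar> \<le> \<delta>" if "known Q p" "between y y' p" for Q p
    using between_value[OF known(2,4) that, of 1] goals v by (auto simp: abs_le_iff)
  show ?thesis
  proof (cases "favoured m (x, y')")
    case True
    have "solves (4 * \<delta>) (8 * n) P (move_cut (4 * \<delta>) n m (\<lambda>p. (p, y')) x x')"
    proof (rule solves_move_cut[OF m known(1,3) _ _ \<delta>])
      show "(\<exists>y. known P y \<and> (\<lambda>p. (p, y')) = (\<lambda>p. (p, y))) \<or>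
          (\<exists>x. known P x \<and> (\<lambda>p. (p, y')) = (\<lambda>p. (x, p)))"
        using known(4) by blast
      \<comment> \<open>The half point of player 1 has \<open>x\<close> and \<open>x'\<close> weakly
        to its left and \<open>y'\<close> weakly to its right.\<close>
      show "fst (fst (p, y')) \<le> fst (snd (p, y'))" if "between x x' p" for p
        using that d(1) d'(1) by (auto simp: on_path_def between_def)
      show "share 1 j (p, y') \<le> share 1 k (p, y') + 4 * \<delta>"
        if "known Q p" "between x x' p" "j < 3" "k < 3" "k \<noteq> m" for Q p j k
        using content_near_path[OF s x[OF that(1,2)] y[OF known(4) between_ends(2)] m that(3-5)] .
    qed (use True d' in auto)
    then show ?thesis using True by (simp add: refine_def)
  next
    case False
    have "solves (4 * \<delta>) (8 * n) P (move_cut (4 * \<delta>) n m (\<lambda>p. (x, p)) y y')"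
    proof (rule solves_move_cut[OF m known(2,4) _ _ \<delta>])
      show "(\<exists>z. known P z \<and> (\<lambda>p. (x, p)) = (\<lambda>p. (p, z))) \<or>
          (\<exists>z. known P z \<and> (\<lambda>p. (x, p)) = (\<lambda>p. (z, p)))"
        using known(1) by blast
      show "fst (fst (x, p)) \<le> fst (snd (x, p))" if "between y y' p" for p
        using that d(1) d'(1) by (auto simp: on_path_def between_def)
      show "share 1 j (x, p) \<le> share 1 k (x, p) + 4 * \<delta>"
        if "known Q p" "between y y' p" "j < 3" "k < 3" "k \<noteq> m" for Q p j k
        using content_near_path[OF s x[OF known(1) between_ends(1)] y[OF that(1,2)] m that(3-5)] .
    qed (use not_favoured_imp_contested[OF False] d in auto)
    then show ?thesis using False by (simp add: refine_def)
  qed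
qed

lemma cut_answer_mono:
  assumes i: "i \<in> {1..3}" and "0 \<le> \<alpha>" "\<alpha> \<le> \<beta>" "\<beta> \<le> 1"
  shows "cut_answer (v i) \<alpha> \<le> cut_answer (v i) \<beta>"
proof (rule ccontr)
  assume less: "\<not> cut_answer (v i) \<alpha> \<le> cut_answer (v i) \<beta>"
  have \<alpha>: "cut_answer (v i) \<alpha> \<in> {0..1}" "val (v i) {0..cut_answer (v i) \<alpha>} = \<alpha>"
    by (rule cut_answer_correct[OF density[OF i]]; use assms in simp)+
  have \<beta>: "cut_answer (v i) \<beta> \<in> {0..1}" "val (v i) {0..cut_answer (v i) \<beta>} = \<beta>"
    by (rule cut_answer_correct[OF density[OF i]]; use assms in simp)+
  \<comment> \<open>With \<open>\<alpha> \<le> \<beta>\<close> this forces equality, and equal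
    queries have equal answers.\<close>
  have "\<beta> \<le> \<alpha>"
    using val_mono[OF i, of "cut_answer (v i) \<beta>" "cut_answer (v i) \<alpha>"] \<alpha> \<beta> less by simp
  then show False using assms(3) less by simp
qed

lemma on_pathI:
  assumes "0 \<le> s" "s \<le> 1/3" "known P x" "known P y"
    and "fst x = cut_answer (v 1) (left_goal m s)" "snd x 1 = left_goal m s"
    and "fst y = cut_answer (v 1) (right_goal m s)" "snd y 1 = right_goal m s"
  shows "on_path m s P (x, y)"
  unfolding on_path_def fst_conv snd_conv assms(5-8)
  using assms(3,4) goal_bounds[OF assms(1,2), of m] by (intro conjI cut_answer_mono) simp_all

text \<open>The invariant is that of \<open>solves_bisect\<close>, but the path parameter is
  bisected instead of a cut. A round takes two probes, hence \<open>8 * n\<close>.\<close>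

lemma solves_shrink:
  assumes "on_path m s P d" "favoured m d" "on_path m t P d'" "contested m d'"
    and "0 \<le> t" "t \<le> s" "s \<le> 1/3" "s - t \<le> w * 2 ^ n" "m < 3"
    and "\<And>Q s t d d'. P \<subseteq> Q \<Longrightarrow> on_path m s Q d \<Longrightarrow> favoured m d \<Longrightarrow> on_path m t Q d' \<Longrightarrow>
      contested m d' \<Longrightarrow> s \<le> 1/3 \<Longrightarrow> \<bar>s - t\<bar> \<le> w \<Longrightarrow> solves \<epsilon> N Q (k d d')"
  shows "solves \<epsilon> (N + 8 * n) P (shrink m n k s t d d')"
  using assms
proof (induction n arbitrary: P s t d d')
  case 0
  then show ?case by simp
next
  case (Suc n)
  let ?r = "(s + t) / 2"
  have r: "0 \<le> ?r" "?r \<le> 1/3" using Suc.prems by auto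
  have w: "?r - t \<le> w * 2 ^ n" "s - ?r \<le> w * 2 ^ n" using Suc.prems(8) by (auto simp: field_simps)
  have "solves \<epsilon> (((N + 8 * n) + 4) + 4) P (shrink m (Suc n) k s t d d')"
    unfolding shrink.simps
  proof (rule solves_probe)
    fix x Q
    assume x: "P \<subseteq> Q" "known Q x" "fst x = cut_answer (v 1) (left_goal m ?r)" "snd x 1 = left_goal m ?r"
    show "solves \<epsilon> ((N + 8 * n) + 4) Q (probe 1 (right_goal m ?r) (\<lambda>y.
       if favoured m (x, y) then shrink m n k ?r t (x, y) d' else shrink m n k s ?r d (x, y)))"
    proof (rule solves_probe)
      fix y R
      assume y: "Q \<subseteq> R" "known R y" "fst y = cut_answer (v 1) (right_goal m ?r)"
        "snd y 1 = right_goal m ?r"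
      have xy: "on_path m ?r R (x, y)" using x y r known_mono by (intro on_pathI) auto
      have PR: "P \<subseteq> R" using x(1) y(1) by blast
      have d: "on_path m s R d" "on_path m t R d'" using Suc.prems(1,3) PR on_path_mono by auto
      have k: "\<And>S s t d d'. R \<subseteq> S \<Longrightarrow> on_path m s S d \<Longrightarrow> favoured m d \<Longrightarrow> on_path m t S d' \<Longrightarrow>
          contested m d' \<Longrightarrow> s \<le> 1/3 \<Longrightarrow> \<bar>s - t\<bar> \<le> w \<Longrightarrow> solves \<epsilon> N S (k d d')"
        using Suc.prems(10) PR by (meson order_trans)
      show "solves \<epsilon> (N + 8 * n) R (if favoured m (x, y) then shrink m n k ?r t (x, y) d'
          else shrink m n k s ?r d (x, y))"
      proof (cases "favoured m (x, y)")
        case True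
        have "solves \<epsilon> (N + 8 * n) R (shrink m n k ?r t (x, y) d')"
          by (rule Suc.IH[OF xy True d(2) Suc.prems(4,5) _ r(2) w(1) Suc.prems(9) k])
            (use Suc.prems(6) in auto)
        then show ?thesis using True by simp
      next
        case False
        have "solves \<epsilon> (N + 8 * n) R (shrink m n k s ?r d (x, y))"
          by (rule Suc.IH[OF d(1) Suc.prems(2) xy not_favoured_imp_contested[OF False] r(1) _
                Suc.prems(7) w(2) Suc.prems(9) k])
            (use Suc.prems(6) in auto)
        then show ?thesis using False by simp
      qed
    qed (use goal_bounds[OF r, of m] in auto)
  qed (use goal_bounds[OF r, of m] in auto)
  then show ?case by (simp add: algebra_simps)
qed

lemma on_path_vanished:
  assumes "known P c" "fst c = cut_answer (v 1) (1/2)" "snd c 1 = 1/2"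
  shows "on_path m 0 P (vanished m c)"
  using assms known_start_point known_end_point
  by (auto simp: on_path_def vanished_def left_goal_def right_goal_def known_def
      start_point_def end_point_def)

text \<open>The two ends of \<open>m\<close> coincide, so its share is 0 and player 2 weakly prefers
  any other piece.\<close>

lemma contested_vanished:
  assumes "known P c" "m < 3"
  shows "contested m (vanished m c)"
  using known_value_bounds[OF assms(1), of 2] assms(2)
  unfolding contested_def
  by (intro bexI[of _ 2] exI[of _ "if m = 0 then 1 else 0"])
    (auto simp: share_def vanished_def start_point_def end_point_def less_3_iff)

section \<open>The whole protocol and its query count\<close>

lemma solves_protocol:
  assumes \<delta>: "1 / 2 ^ n \<le> \<delta>"
  shows "solves (4 * \<delta>) (16 * n + 12) {} (protocol (4 * \<delta>) n)"
proof -
  have "0 < \<delta>" using \<delta> by (smt (verit) divide_pos_pos zero_less_power)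
  \<comment> \<open>\<open>shrink\<close> and \<open>refine\<close> take \<open>8 * n\<close>
    queries each, and the probes at 1/3, 2/3 and 1/2 take 4 each.\<close>
  have "solves (4 * \<delta>) (((8 * n + 8 * n + 4) + 4) + 4) {} (protocol (4 * \<delta>) n)"
    unfolding protocol_def
  proof (rule solves_probe)
    fix x P
    assume x: "known P x" "fst x = cut_answer (v 1) (1/3)" "snd x 1 = 1/3"
    show "solves (4 * \<delta>) ((8 * n + 8 * n + 4) + 4) P (probe 1 (2/3) (\<lambda>y.
      if \<exists>\<sigma>. fair (4 * \<delta>) (x, y) \<sigma> then finish (4 * \<delta>) (x, y)
      else let m = SOME m. m < 3 \<and> favoured m (x, y) in
        probe 1 (1/2) (\<lambda>c. shrink m n (refine (4 * \<delta>) n m) (1/3) 0 (x, y) (vanished m c))))"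
    proof (rule solves_probe)
      fix y Q
      assume y: "P \<subseteq> Q" "known Q y" "fst y = cut_answer (v 1) (2/3)" "snd y 1 = 2/3"
      have xQ: "known Q x" using x(1) y(1) known_mono by blast
      have le: "fst x \<le> fst y" using x(2) y(3) cut_answer_mono by simp
      show "solves (4 * \<delta>) (8 * n + 8 * n + 4) Q (
        if \<exists>\<sigma>. fair (4 * \<delta>) (x, y) \<sigma> then finish (4 * \<delta>) (x, y)
        else let m = SOME m. m < 3 \<and> favoured m (x, y) in
          probe 1 (1/2) (\<lambda>c. shrink m n (refine (4 * \<delta>) n m) (1/3) 0 (x, y) (vanished m c)))"
      proof (cases "\<exists>\<sigma>. fair (4 * \<delta>) (x, y) \<sigma>")
        case True
        then show ?thesis using solves_mono[OF solves_finish[OF xQ y(2) le True]] by simp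
      next
        case False
        define m where "m = (SOME m. m < 3 \<and> favoured m (x, y))"
        have "\<exists>m<3. favoured m (x, y)"
          using fair_or_favoured[of "(x, y)" "4 * \<delta>"] False x(3) y(4) \<open>0 < \<delta>\<close>
          by (auto simp: share_def)
        then have m: "m < 3" "favoured m (x, y)"
          unfolding m_def by (metis (mono_tags, lifting) someI_ex)+
        have goal: "left_goal m (1/3) = 1/3" "right_goal m (1/3) = 2/3"
          by (auto simp: left_goal_def right_goal_def)
        have "solves (4 * \<delta>) (8 * n + 8 * n + 4) Q
          (probe 1 (1/2) (\<lambda>c. shrink m n (refine (4 * \<delta>) n m) (1/3) 0 (x, y) (vanished m c)))"
        proof (rule solves_probe)
          fix c R
          assume c: "Q \<subseteq> R" "known R c" "fst c = cut_answer (v 1) (1/2)" "snd c 1 = 1/2"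
          have "on_path m (1/3) R (x, y)"
            using x y xQ c(1) known_mono by (intro on_pathI) (auto simp: goal)
          moreover have "1 / 3 - 0 \<le> \<delta> * 2 ^ n"
            using \<delta> by (simp add: field_simps)
          ultimately show "solves (4 * \<delta>) (8 * n + 8 * n) R
            (shrink m n (refine (4 * \<delta>) n m) (1/3) 0 (x, y) (vanished m c))"
            using m on_path_vanished[OF c(2-4)] contested_vanished[OF c(2) m(1)] solves_refine[OF m(1)] \<delta>
            by (intro solves_shrink) auto
        qed auto
        then show ?thesis using False by (simp add: Let_def flip: m_def)
      qed
    qed auto
  qed auto
  then show ?thesis by (simp add: algebra_simps)
qed

end

theorem theorem4p1:
  "\<exists>C \<epsilon>\<^sub>0 :: real. C > 0 \<and> 0 < \<epsilon>\<^sub>0 \<and> \<epsilon>\<^sub>0 < 1 \<and>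
     (\<forall>\<epsilon>. 0 < \<epsilon> \<and> \<epsilon> < \<epsilon>\<^sub>0 \<longrightarrow>
       (\<exists>p. rw_protocol 3 p \<and>
         (\<forall>v. instance_profile 3 v \<longrightarrow>
            real (num_queries v p) \<le> C * ln (1 / \<epsilon>) \<and>
            connected_allocation 3 (outcome v p) \<and>
            envy_free_upto 3 \<epsilon> v (outcome v p))))"
proof (rule exI[of _ "76 / ln 2"], rule exI[of _ "1/2"], intro conjI allI impI)
  fix \<epsilon> :: real
  assume \<epsilon>: "0 < \<epsilon> \<and> \<epsilon> < 1 / 2"
  \<comment> \<open>This makes \<open>1 / 2 ^ n\<close> at most \<open>\<epsilon> / 4\<close>, the
    value taken for \<open>\<delta>\<close>, so that the envy bound \<open>4 * \<delta>\<close> is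
    \<open>\<epsilon>\<close>.\<close>
  define n where "n = nat \<lceil>log 2 (4 / \<epsilon>)\<rceil>"
  have L: "log 2 (4 / \<epsilon>) = 2 + log 2 (1 / \<epsilon>)"
    using \<epsilon> log_mult[of 2 4 "1 / \<epsilon>"] log_pow_cancel[of 2 2] by simp
  have L1: "1 \<le> log 2 (1 / \<epsilon>)" using \<epsilon> by (simp add: le_log_iff field_simps)
  have n: "log 2 (4 / \<epsilon>) \<le> n" "n \<le> 3 + log 2 (1 / \<epsilon>)" unfolding n_def using L L1 by linarith+
  have "4 / \<epsilon> \<le> 2 ^ n"
    using n(1) \<epsilon> by (simp add: log_le_iff powr_realpow)
  then have "1 / 2 ^ n \<le> \<epsilon> / 4" using \<epsilon> by (simp add: field_simps)
  then have solves: "three_players.solves v \<epsilon> (16 * n + 12) {} (protocol \<epsilon> n)"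
    if "instance_profile 3 v" for v
    using three_players.solves_protocol[of v n "\<epsilon> / 4"] that by (simp add: three_players_def)
  \<comment> \<open>With \<open>L = log 2 (1 / \<epsilon>)\<close>, \<open>n \<le> 3 + L\<close>
    gives \<open>16 * n + 12 \<le> 16 * L + 60\<close>; the threshold 1/2 ensures
    \<open>1 \<le> L\<close>, and so 60 is at most \<open>60 * L\<close>.\<close>
  have "real (16 * n + 12) \<le> 76 * log 2 (1 / \<epsilon>)" using n L1 by simp
  also have "\<dots> = 76 / ln 2 * ln (1 / \<epsilon>)" by (simp add: log_def)
  finally have "real (num_queries v (protocol \<epsilon> n)) \<le> 76 / ln 2 * ln (1 / \<epsilon>)"
    if "instance_profile 3 v" for v
    using solves[OF that] that by (simp add: three_players.solves_def three_players_def)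
  then show "\<exists>p. rw_protocol 3 p \<and>
         (\<forall>v. instance_profile 3 v \<longrightarrow>
            real (num_queries v p) \<le> 76 / ln 2 * ln (1 / \<epsilon>) \<and>
            connected_allocation 3 (outcome v p) \<and>
            envy_free_upto 3 \<epsilon> v (outcome v p))"
    using solves
    by (intro exI[of _ "protocol \<epsilon> n"])
      (auto simp: rw_protocol_def three_players.solves_def three_players_def)
qed auto

end
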